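(* For positive integers $n$ and $m$, let $\mathcal{A}(n,m)$ be the $m$th order $n$-dimensional essential MO tensor, i.e. the real symmetric tensor with entries $$\mathcal{A}(n,m)_{i_1,\dots,i_m}=\begin{cases} i_1, & i_1=i_2=\cdots=i_m,\\ \min\{i_1,\dots,i_m\}-1, & \text{otherwise},\end{cases}\qquad i_1,\dots,i_m\in\{1,\dots,n\}.$$ Then $\mathcal{A}(n,m)$ is positive definite for all $n$ and all even $m$. Furthermore, $\mathcal{A}(n,m)$ is a completely positive tensor for all $n$ and $m$, with $$\mathcal{A}(n,m)=\sum_{i=1}^n \mathbf{e}_i^m+\sum_{i=2}^n \mathbf{r}_i^m,$$ where $\mathbf{e}_i,\mathbf{r}_i\in\mathbb{R}^n$ are given by $(\mathbf{e}_i)_j=1$ if $j=i$ and $0$ otherwise, and $(\mathbf{r}_i)_j=1$ if $j\ge i$ and $0$ otherwise.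
   Context: For $\mathbf{u}\in\mathbb{R}^n$, $\mathbf{u}^m$ denotes the order-$m$, dimension-$n$ symmetric rank-one tensor with entries $u_{i_1}u_{i_2}\cdots u_{i_m}$. For a real tensor $\mathcal{A}=(a_{i_1\cdots i_m})$ of order $m$ and dimension $n$ and $\mathbf{x}\in\mathbb{R}^n$, put $\mathcal{A}\mathbf{x}^m=\sum_{i_1,\dots,i_m=1}^n a_{i_1\cdots i_m}x_{i_1}\cdots x_{i_m}$; $\mathcal{A}$ is positive definite if $\mathcal{A}\mathbf{x}^m>0$ for all nonzero $\mathbf{x}\in\mathbb{R}^n$. A symmetric tensor $\mathcal{A}$ of order $m$ and dimension $n$ is completely positive if there exist an integer $r$ and entrywise nonnegative vectors $\mathbf{u}^{(1)},\dots,\mathbf{u}^{(r)}\in\mathbb{R}_+^n$ such that $\mathcal{A}=\sum_{k=1}^r(\mathbf{u}^{(k)})^m$. *)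

theory Defs
  imports Complex_Main "HOL-Library.Function_Algebras" "HOL-Combinatorics.Permutations"
begin

text \<open>
  Vectors of dimension \<open>n\<close> are functions on \<open>nat\<close> and tensors of order \<open>m\<close> and dimension \<open>n\<close> are
  functions on lists of indices, with indices running through \<open>{1..n}\<close>. Both are required to
  vanish outside their index set, so that equality, the zero vector and (via
  \<^theory>\<open>HOL-Library.Function_Algebras\<close>) sums are those of functions.
\<close>

definition vecs :: "nat \<Rightarrow> (nat \<Rightarrow> real) set" where
  "vecs n = {x. \<forall>j. j \<notin> {1..n} \<longrightarrow> x j = 0}"

definition nonneg_vecs :: "nat \<Rightarrow> (nat \<Rightarrow> real) set" where
  "nonneg_vecs n = {x \<in> vecs n. \<forall>j\<in>{1..n}. 0 \<le> x j}"

definition multi_indices :: "nat \<Rightarrow> nat \<Rightarrow> nat list set" where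
  "multi_indices n m = {is. length is = m \<and> set is \<subseteq> {1..n}}"

definition tensors :: "nat \<Rightarrow> nat \<Rightarrow> (nat list \<Rightarrow> real) set" where
  "tensors n m = {A. \<forall>is. is \<notin> multi_indices n m \<longrightarrow> A is = 0}"

definition symmetric_tensor :: "nat \<Rightarrow> nat \<Rightarrow> (nat list \<Rightarrow> real) \<Rightarrow> bool" where
  "symmetric_tensor n m A \<longleftrightarrow> A \<in> tensors n m \<and>
     (\<forall>is \<in> multi_indices n m. \<forall>p. p permutes {..<m} \<longrightarrow> A (permute_list p is) = A is)"

definition vec_power :: "nat \<Rightarrow> nat \<Rightarrow> (nat \<Rightarrow> real) \<Rightarrow> (nat list \<Rightarrow> real)" where
  "vec_power n m u = (\<lambda>is. if is \<in> multi_indices n m then prod_list (map u is) else 0)"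

definition tensor_form :: "nat \<Rightarrow> nat \<Rightarrow> (nat list \<Rightarrow> real) \<Rightarrow> (nat \<Rightarrow> real) \<Rightarrow> real" where
  "tensor_form n m A x = (\<Sum>is\<in>multi_indices n m. A is * prod_list (map x is))"

definition positive_definite :: "nat \<Rightarrow> nat \<Rightarrow> (nat list \<Rightarrow> real) \<Rightarrow> bool" where
  "positive_definite n m A \<longleftrightarrow> A \<in> tensors n m \<and>
     (\<forall>x \<in> vecs n. x \<noteq> 0 \<longrightarrow> tensor_form n m A x > 0)"

definition completely_positive :: "nat \<Rightarrow> nat \<Rightarrow> (nat list \<Rightarrow> real) \<Rightarrow> bool" where
  "completely_positive n m A \<longleftrightarrow> symmetric_tensor n m A \<and>
     (\<exists>(r::nat) u. (\<forall>k\<in>{1..r}. u k \<in> nonneg_vecs n) \<and> A = (\<Sum>k=1..r. vec_power n m (u k)))"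

text \<open>Intended for \<open>m \<ge> 1\<close>; the entry at the empty list (\<open>m = 0\<close>) has no meaning.\<close>

definition essential_MO :: "nat \<Rightarrow> nat \<Rightarrow> (nat list \<Rightarrow> real)" where
  "essential_MO n m = (\<lambda>is.
     if is \<in> multi_indices n m then
       if \<forall>i\<in>set is. i = hd is then real (hd is) else real (Min (set is)) - 1
     else 0)"

definition e_vec :: "nat \<Rightarrow> nat \<Rightarrow> (nat \<Rightarrow> real)" where
  "e_vec n i = (\<lambda>j. if j \<in> {1..n} \<and> j = i then 1 else 0)"

definition r_vec :: "nat \<Rightarrow> nat \<Rightarrow> (nat \<Rightarrow> real)" where
  "r_vec n i = (\<lambda>j. if j \<in> {1..n} \<and> i \<le> j then 1 else 0)"

end

theory Submission
  imports Defs
begin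

text \<open>
  Off the diagonal, \<open>min{i\<^sub>1,\<dots>,i\<^sub>m} - 1\<close> counts the \<open>i \<in> {2..n}\<close> below all indices, i.e. those
  for which the entry of \<open>r\<^sub>i\<^sup>m\<close> is 1; on the diagonal the tensors \<open>e\<^sub>i\<^sup>m\<close> add the missing 1.
  The form of a rank-one tensor \<open>u\<^sup>m\<close> at \<open>x\<close> is the \<open>m\<close>-th power of the inner product of \<open>u\<close> and \<open>x\<close>,
  so for even \<open>m\<close> the form of the decomposition is at least the sum of the \<open>x\<^sub>i\<^sup>m\<close>.
\<close>

lemma sum_fun_apply: "(\<Sum>i\<in>I. f i) x = (\<Sum>i\<in>I. f i x)"
  for f :: "'i \<Rightarrow> 'a \<Rightarrow> 'b::comm_monoid_add"
  by (induction I rule: infinite_finite_induct) auto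

lemma prod_list_map_of_bool:
  "prod_list (map (\<lambda>j. of_bool (P j)) xs) = (of_bool (\<forall>j\<in>set xs. P j) :: 'a::comm_semiring_1)"
  by (induction xs) auto

lemma prod_list_map_mult:
  "prod_list (map (\<lambda>j. f j * g j) xs) = prod_list (map f xs) * (prod_list (map g xs) :: 'a::comm_monoid_mult)"
  by (induction xs) (auto simp: ac_simps)

text \<open>Distributivity: expanding the \<open>m\<close>-th power yields one summand for each word
  of length \<open>m\<close> over \<open>S\<close>. The induction splits off the head of the word,
  which ranges over \<open>S\<close> independently of the tail.\<close>

lemma sum_prod_list_lists_length:
  fixes f :: "'a \<Rightarrow> 'b::comm_semiring_1"
  shows "(\<Sum>xs | set xs \<subseteq> S \<and> length xs = m. prod_list (map f xs)) = (\<Sum>j\<in>S. f j) ^ m"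
proof (induction m)
  case (Suc m)
  let ?L = "{xs. set xs \<subseteq> S \<and> length xs = m}"
  have "(\<Sum>xs | set xs \<subseteq> S \<and> length xs = Suc m. prod_list (map f xs)) =
      (\<Sum>(xs, j)\<in>?L \<times> S. prod_list (map f (j # xs)))"
    unfolding lists_length_Suc_eq
    by (subst sum.reindex) (auto simp: inj_on_def intro!: sum.cong)
  also have "\<dots> = (\<Sum>xs\<in>?L. prod_list (map f xs)) * (\<Sum>j\<in>S. f j)"
    unfolding sum_product sum.cartesian_product by (simp add: mult.commute)
  finally show ?case
    by (simp add: Suc.IH mult.commute)
next
  case 0
  have "{xs. set xs \<subseteq> S \<and> length xs = 0} = {[]}"
    by auto
  then show ?case
    by simp
qed

lemma multi_indices_eq: "multi_indices n m = {is. set is \<subseteq> {1..n} \<and> length is = m}"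
  by (auto simp: multi_indices_def)

lemma tensor_form_add:
  "tensor_form n m (A + B) x = tensor_form n m A x + tensor_form n m B x"
  by (simp add: tensor_form_def distrib_right sum.distrib)

lemma tensor_form_sum:
  "tensor_form n m (\<Sum>i\<in>I. A i) x = (\<Sum>i\<in>I. tensor_form n m (A i) x)"
  by (simp add: tensor_form_def sum_fun_apply sum_distrib_right sum.swap[of _ I])

lemma tensor_form_vec_power:
  "tensor_form n m (vec_power n m u) x = (\<Sum>j=1..n. u j * x j) ^ m"
proof -
  have "tensor_form n m (vec_power n m u) x =
      (\<Sum>is\<in>multi_indices n m. prod_list (map (\<lambda>j. u j * x j) is))"
    unfolding tensor_form_def
    by (intro sum.cong) (auto simp: vec_power_def prod_list_map_mult)
  then show ?thesis
    by (simp add: multi_indices_eq sum_prod_list_lists_length)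
qed

text \<open>Multiplication is commutative, so an entry depends only on the multiset of its indices,
  which \<open>permute_list\<close> preserves.\<close>

lemma symmetric_tensor_vec_power: "symmetric_tensor n m (vec_power n m u)"
proof -
  have "vec_power n m u (permute_list p is) = vec_power n m u is"
    if "is \<in> multi_indices n m" and p: "p permutes {..<m}" for p "is"
  proof -
    have p': "p permutes {..<length is}"
      using that by (simp add: multi_indices_def)
    have "prod_list (map u (permute_list p is)) = prod_list (map u is)"
      by (simp flip: prod_mset_prod_list add: mset_permute_list[OF p'])
    moreover have "permute_list p is \<in> multi_indices n m"
      using that p' by (simp add: multi_indices_def)
    ultimately show ?thesis
      using that by (simp add: vec_power_def)
  qed
  then show ?thesis
    by (simp add: symmetric_tensor_def tensors_def vec_power_def)
qed

lemma symmetric_tensor_sum: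
  assumes "\<And>i. i \<in> I \<Longrightarrow> symmetric_tensor n m (A i)"
  shows "symmetric_tensor n m (\<Sum>i\<in>I. A i)"
  using assms by (simp add: symmetric_tensor_def tensors_def sum_fun_apply)

text \<open>Frees the index set from the form \<open>{1..r}\<close> of the definition by enumerating
  \<open>I\<close>, so that a disjoint sum of two families can be used below.\<close>

lemma completely_positive_sum_vec_power:
  assumes "finite I" and "\<And>i. i \<in> I \<Longrightarrow> u i \<in> nonneg_vecs n"
  shows "completely_positive n m (\<Sum>i\<in>I. vec_power n m (u i))"
proof -
  obtain h where h: "bij_betw h {1..card I} I"
    using ex_bij_betw_nat_finite_1[OF assms(1)] by blast
  have "(\<Sum>i\<in>I. vec_power n m (u i)) = (\<Sum>k=1..card I. vec_power n m (u (h k)))"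
    using sum.reindex_bij_betw[OF h, of "\<lambda>i. vec_power n m (u i)"] by simp
  moreover have "u (h k) \<in> nonneg_vecs n" if "k \<in> {1..card I}" for k
    using bij_betwE[OF h] that assms(2) by blast
  ultimately show ?thesis
    unfolding completely_positive_def
    by (auto intro!: symmetric_tensor_sum symmetric_tensor_vec_power exI[of _ "card I"]
        exI[of _ "\<lambda>k. u (h k)"])
qed

lemma e_vec_nonneg: "e_vec n i \<in> nonneg_vecs n"
  by (simp add: nonneg_vecs_def vecs_def e_vec_def)

lemma r_vec_nonneg: "r_vec n i \<in> nonneg_vecs n"
  by (simp add: nonneg_vecs_def vecs_def r_vec_def)

text \<open>Entries of a multi-index lie in \<open>{1..n}\<close>, so only the test
  \<open>j = i\<close> of \<open>e_vec\<close> remains; a product of such indicators is the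
  indicator of the conjunction.\<close>

lemma vec_power_e_vec:
  assumes "is \<in> multi_indices n m"
  shows "vec_power n m (e_vec n i) is = of_bool (\<forall>j\<in>set is. j = i)"
proof -
  have "map (e_vec n i) is = map (\<lambda>j. of_bool (j = i)) is"
    using assms by (auto simp: e_vec_def multi_indices_def)
  then show ?thesis
    using assms by (simp only: vec_power_def prod_list_map_of_bool if_True)
qed

lemma vec_power_r_vec:
  assumes "is \<in> multi_indices n m"
  shows "vec_power n m (r_vec n i) is = of_bool (\<forall>j\<in>set is. i \<le> j)"
proof -
  have "map (r_vec n i) is = map (\<lambda>j. of_bool (i \<le> j)) is"
    using assms by (auto simp: r_vec_def multi_indices_def)
  then show ?thesis
    using assms by (simp only: vec_power_def prod_list_map_of_bool if_True)
qed

lemma essential_MO_decomposition: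
  assumes "m \<ge> 1"
  shows "essential_MO n m =
    (\<Sum>i=1..n. vec_power n m (e_vec n i)) + (\<Sum>i=2..n. vec_power n m (r_vec n i))"
proof
  fix "is" :: "nat list"
  show "essential_MO n m is =
    ((\<Sum>i=1..n. vec_power n m (e_vec n i)) + (\<Sum>i=2..n. vec_power n m (r_vec n i))) is"
  proof (cases "is \<in> multi_indices n m")
    case False
    then show ?thesis
      by (simp add: essential_MO_def vec_power_def sum_fun_apply)
  next
    case True
    then have ne: "is \<noteq> []" and sub: "set is \<subseteq> {1..n}"
      using assms by (auto simp: multi_indices_def)
    define \<mu> where "\<mu> = Min (set is)"
    have \<mu>: "\<mu> \<in> set is"
      using ne by (simp add: \<mu>_def)
    with sub have \<mu>_bounds: "1 \<le> \<mu>" "\<mu> \<le> n"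
      by auto
    \<comment> \<open>A number is below all entries of \<open>is\<close> exactly if it is below
      their minimum.\<close>
    have "(\<Sum>i=2..n. vec_power n m (r_vec n i) is) = (\<Sum>i=2..n. of_bool (i \<le> \<mu>))"
      using ne True by (simp add: vec_power_r_vec \<mu>_def)
    also have "\<dots> = real (card ({2..n} \<inter> {i. i \<le> \<mu>}))"
      by simp
    also have "{2..n} \<inter> {i. i \<le> \<mu>} = {2..\<mu>}"
      using \<mu>_bounds by auto
    \<comment> \<open>For \<open>\<mu> = 1\<close> the interval \<open>{2..\<mu>}\<close> is empty
      and both sides are 0.\<close>
    finally have r: "(\<Sum>i=2..n. vec_power n m (r_vec n i) is) = real \<mu> - 1"
      using \<mu>_bounds by (simp add: of_nat_diff)
    \<comment> \<open>A nonempty list can be constant only with the value of its head, so at most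
      one \<open>e_vec n i\<close> contributes.\<close>
    have "vec_power n m (e_vec n i) is =
        (if i = hd is then of_bool (\<forall>j\<in>set is. j = hd is) else 0)" for i
    proof (cases "i = hd is")
      case True
      then show ?thesis
        using \<open>is \<in> multi_indices n m\<close> by (simp add: vec_power_e_vec)
    next
      case False
      then have "\<not> (\<forall>j\<in>set is. j = i)"
        using hd_in_set[OF ne] by metis
      with False show ?thesis
        using \<open>is \<in> multi_indices n m\<close> by (simp only: vec_power_e_vec if_False of_bool_eq)
    qed
    then have "(\<Sum>i=1..n. vec_power n m (e_vec n i) is) =
        (\<Sum>i=1..n. if i = hd is then of_bool (\<forall>j\<in>set is. j = hd is) else 0)"
      by (simp only:)
    moreover have "hd is \<in> {1..n}"
      using ne sub by (meson hd_in_set subsetD)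
    ultimately have e: "(\<Sum>i=1..n. vec_power n m (e_vec n i) is) =
        of_bool (\<forall>j\<in>set is. j = hd is)"
      by simp
    \<comment> \<open>On the diagonal the two sums therefore give
      \<open>1 + (\<mu> - 1) = hd is\<close>.\<close>
    have "\<mu> = hd is" if "\<forall>j\<in>set is. j = hd is"
      using that \<mu> by blast
    then show ?thesis
      using True r e by (auto simp: essential_MO_def sum_fun_apply \<mu>_def)
  qed
qed

lemma positive_definite_essential_MO:
  assumes "m \<ge> 1" and "even m"
  shows "positive_definite n m (essential_MO n m)"
proof -
  have "tensor_form n m (essential_MO n m) x > 0" if "x \<in> vecs n" "x \<noteq> 0" for x
  proof -
    obtain k where "x k \<noteq> 0"
      using \<open>x \<noteq> 0\<close> by (auto simp: fun_eq_iff)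
    with \<open>x \<in> vecs n\<close> have k: "k \<in> {1..n}"
      by (auto simp: vecs_def)
    have "(\<Sum>j=1..n. e_vec n i j * x j) = x i" if "i \<in> {1..n}" for i
    proof -
      have "(\<Sum>j=1..n. e_vec n i j * x j) = (\<Sum>j=1..n. if j = i then x j else 0)"
        by (intro sum.cong) (auto simp: e_vec_def)
      with that show ?thesis
        by simp
    qed
    then have "tensor_form n m (essential_MO n m) x =
        (\<Sum>i=1..n. x i ^ m) + (\<Sum>i=2..n. (\<Sum>j=1..n. r_vec n i j * x j) ^ m)"
      by (simp add: essential_MO_decomposition[OF \<open>m \<ge> 1\<close>] tensor_form_add tensor_form_sum
          tensor_form_vec_power)
    \<comment> \<open>Even powers are nonnegative, and the summand at \<open>k\<close> is strictly
      positive.\<close>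
    moreover have "(\<Sum>i=1..n. x i ^ m) > 0"
      using k \<open>x k \<noteq> 0\<close> \<open>even m\<close>
      by (intro sum_pos2[of _ k]) (auto simp: zero_less_power_eq zero_le_even_power)
    moreover have "(\<Sum>i=2..n. (\<Sum>j=1..n. r_vec n i j * x j) ^ m) \<ge> 0"
      using \<open>even m\<close> by (intro sum_nonneg zero_le_even_power)
    ultimately show ?thesis
      by linarith
  qed
  then show ?thesis
    by (simp add: positive_definite_def tensors_def essential_MO_def)
qed

lemma completely_positive_essential_MO:
  assumes "m \<ge> 1"
  shows "completely_positive n m (essential_MO n m)"
proof -
  \<comment> \<open>The disjoint sum \<open><+>\<close> keeps the two families apart: their index
    ranges overlap, and for \<open>n \<ge> 2\<close> even the vectors \<open>e_vec n n\<close> and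
    \<open>r_vec n n\<close> coincide.\<close>
  have "completely_positive n m
      (\<Sum>s\<in>{1..n} <+> {2..n}. vec_power n m (case_sum (e_vec n) (r_vec n) s))"
    by (intro completely_positive_sum_vec_power) (auto simp: e_vec_nonneg r_vec_nonneg)
  then show ?thesis
    by (simp add: sum.Plus essential_MO_decomposition[OF assms])
qed

theorem theorem3p5:
  fixes n m :: nat
  assumes "n \<ge> 1" and "m \<ge> 1"
  shows "(even m \<longrightarrow> positive_definite n m (essential_MO n m)) \<and>
    completely_positive n m (essential_MO n m) \<and>
    essential_MO n m = (\<Sum>i=1..n. vec_power n m (e_vec n i)) + (\<Sum>i=2..n. vec_power n m (r_vec n i))"
  using positive_definite_essential_MO completely_positive_essential_MO
    essential_MO_decomposition assms(2) by blast

end
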